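(* Suppose that $\theta>0$, $a,b\in\mathbb{R}$, $\rho\in\mathbb{R}\setminus\{0\}$. The heat kernels $P(t;x,x_0)$ of the perturbed Ornstein-Uhlenbeck operators $L=-\theta\,\partial_x^2+(ax+b)\partial_x+\rho x^2$ are given by the following formulas. 1. If $a^2+4\rho\theta>0$, then, writing $\omega=\sqrt{a^2+4\rho\theta}$, $$\begin{aligned}P(t;x,x_0)=&\left(\frac{\omega}{4\pi\theta\sinh(\omega t)}\right)^{1/2}\exp\left\{\left(\frac a2-\frac{\rho b^2}{a^2+4\rho\theta}\right)t-\frac{a^2b^2}{4\theta\,\omega^{3}}\coth(\omega t)\right\}\\&\cdot\exp\left\{\left(\frac{a}{4\theta}-\frac{\omega}{4\theta}\coth(\omega t)\right)(x^2+x_0^2)\right\}\cdot\exp\left\{\frac{\omega}{2\theta\sinh(\omega t)}\,x x_0\right\}\\&\cdot\exp\left\{\left(-\frac{ab}{2\theta\omega}\coth(\omega t)+\frac{b}{2\theta}\right)x\right\}\cdot\exp\left\{\left(\frac{ab}{2\theta\omega\sinh(\omega t)}+\frac{b}{2\theta}\right)x_0\right\}.\end{aligned}$$ 2. If $a^2+4\rho\theta=0$, then $$\begin{aligned}P(t;x,x_0)=&\left(\frac{1}{4\pi\theta t}\right)^{1/2}\exp\left\{\left(\frac a2-\frac{b^2}{4\theta}\right)t+\frac{a^2b^2}{48\theta}t^3\right\}\\&\cdot\exp\left\{\left(\frac{a}{4\theta}-\frac{1}{4\theta t}\right)(x^2+x_0^2)+\frac{1}{2\theta t}\,xx_0+\left(-\frac{ab}{4\theta}t+\frac{b}{2\theta}\right)(x+x_0)\right\}.\end{aligned}$$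 3. If $a^2+4\rho\theta<0$, then, writing $\omega=\sqrt{-a^2-4\rho\theta}$, $$\begin{aligned}P(t;x,x_0)=&\left(\frac{\omega}{4\pi\theta\sin(\omega t)}\right)^{1/2}\exp\left\{\left(\frac a2-\frac{\rho b^2}{a^2+4\rho\theta}\right)t-\frac{a^2b^2}{4\theta\,\omega^{3}}\cot(\omega t)\right\}\\&\cdot\exp\left\{\left(\frac{a}{4\theta}-\frac{\omega}{4\theta}\cot(\omega t)\right)(x^2+x_0^2)\right\}\cdot\exp\left\{\frac{\omega}{2\theta\sin(\omega t)}\,x x_0\right\}\\&\cdot\exp\left\{\left(\frac{ab}{2\theta\omega}\cot(\omega t)+\frac{b}{2\theta}\right)x\right\}\cdot\exp\left\{\left(-\frac{ab}{2\theta\omega\sin(\omega t)}+\frac{b}{2\theta}\right)x_0\right\}.\end{aligned}$$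
   Context: Here $t>0$ is the time variable, $x,x_0\in\mathbb{R}$, and the formulas are read for those $t$ for which the displayed expressions are defined as real numbers. The paper's notion of heat kernel of $L=-\theta\,\partial_x^2+(ax+b)\partial_x+\rho x^2$ is the following: it is a function of the form $$P=\varphi(t)\exp\{\alpha(t)x^2+\beta(t)xx_0+\gamma(t)x_0^2+\mu(t)x+\nu(t)x_0\}$$ whose coefficients $\varphi,\alpha,\beta,\gamma,\mu,\nu$ are functions of $t$ satisfying $$\dot\alpha=4\theta\alpha^2-2a\alpha-\rho,\quad \dot\beta=4\theta\alpha\beta-a\beta,\quad \dot\gamma=\theta\beta^2,$$ $$\dot\mu=4\theta\alpha\mu-a\mu-2b\alpha,\quad \dot\nu=2\theta\beta\mu-b\beta,\quad \varphi^{-1}\dot\varphi=\theta\mu^2+2\theta\alpha-b\mu$$ (this system expresses the heat equation $\partial_tP+LP=0$ with $L$ acting in $x$). The free integration constants in these equations are fixed in the paper by comparison with the coefficients in the Hermite case $a=0$; no further normalization is stated. *)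

theory Defs
  imports "HOL-Analysis.Analysis"
begin

definition coth :: "real \<Rightarrow> real" where
  "coth z = cosh z / sinh z"

definition perturbed_OU :: "real \<Rightarrow> real \<Rightarrow> real \<Rightarrow> real \<Rightarrow> (real \<Rightarrow> real) \<Rightarrow> real \<Rightarrow> real" where
  "perturbed_OU \<theta> a b \<rho> f x =
     - \<theta> * deriv (deriv f) x + (a * x + b) * deriv f x + \<rho> * x\<^sup>2 * f x"

text \<open>
  \<open>heat_kernel_on \<theta> a b \<rho> T P\<close>: on the time set \<open>T\<close>, \<open>P\<close> is a heat kernel of
  \<open>perturbed_OU \<theta> a b \<rho>\<close>, i.e. a Gaussian in \<open>(x, x0)\<close> whose coefficients satisfy the system of
  ordinary differential equations obtained by inserting this form into
  \<open>\<partial>\<^sub>t P + L P = 0\<close> (cf. lemma \<open>heat_kernel_on_heat_equation\<close>). The condition \<open>\<phi> t \<noteq> 0\<close> is implicit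
  in the occurrence of \<open>1 / \<phi>\<close> in the last equation. No initial condition at \<open>t = 0\<close> is imposed:
  the integration constants are left free, so a heat kernel in this sense is not unique.
\<close>

definition heat_kernel_on ::
    "real \<Rightarrow> real \<Rightarrow> real \<Rightarrow> real \<Rightarrow> real set \<Rightarrow> (real \<Rightarrow> real \<Rightarrow> real \<Rightarrow> real) \<Rightarrow> bool" where
  "heat_kernel_on \<theta> a b \<rho> T P \<longleftrightarrow>
     (\<exists>\<phi> \<alpha> \<beta> \<gamma> \<mu> \<nu> :: real \<Rightarrow> real. \<forall>t\<in>T.
        (\<forall>x x0. P t x x0 =
           \<phi> t * exp (\<alpha> t * x\<^sup>2 + \<beta> t * x * x0 + \<gamma> t * x0\<^sup>2 + \<mu> t * x + \<nu> t * x0)) \<and>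
        (\<alpha> has_real_derivative (4 * \<theta> * (\<alpha> t)\<^sup>2 - 2 * a * \<alpha> t - \<rho>)) (at t) \<and>
        (\<beta> has_real_derivative (4 * \<theta> * \<alpha> t * \<beta> t - a * \<beta> t)) (at t) \<and>
        (\<gamma> has_real_derivative (\<theta> * (\<beta> t)\<^sup>2)) (at t) \<and>
        (\<mu> has_real_derivative (4 * \<theta> * \<alpha> t * \<mu> t - a * \<mu> t - 2 * b * \<alpha> t)) (at t) \<and>
        (\<nu> has_real_derivative (2 * \<theta> * \<beta> t * \<mu> t - b * \<beta> t)) (at t) \<and>
        \<phi> t \<noteq> 0 \<and>
        (\<exists>\<phi>'. (\<phi> has_real_derivative \<phi>') (at t) \<and>
              \<phi>' / \<phi> t = \<theta> * (\<mu> t)\<^sup>2 + 2 * \<theta> * \<alpha> t - b * \<mu> t))"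

lemma heat_kernel_on_heat_equation:
  assumes P: "heat_kernel_on \<theta> a b \<rho> T P" and T: "open T" "t \<in> T"
  shows "((\<lambda>s. P s x x0) has_real_derivative - perturbed_OU \<theta> a b \<rho> (\<lambda>x. P t x x0) x) (at t)"
proof -
  obtain \<phi> \<alpha> \<beta> \<gamma> \<mu> \<nu> :: "real \<Rightarrow> real" where k: "\<forall>t\<in>T.
        (\<forall>x x0. P t x x0 =
           \<phi> t * exp (\<alpha> t * x\<^sup>2 + \<beta> t * x * x0 + \<gamma> t * x0\<^sup>2 + \<mu> t * x + \<nu> t * x0)) \<and>
        (\<alpha> has_real_derivative (4 * \<theta> * (\<alpha> t)\<^sup>2 - 2 * a * \<alpha> t - \<rho>)) (at t) \<and>
        (\<beta> has_real_derivative (4 * \<theta> * \<alpha> t * \<beta> t - a * \<beta> t)) (at t) \<and>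
        (\<gamma> has_real_derivative (\<theta> * (\<beta> t)\<^sup>2)) (at t) \<and>
        (\<mu> has_real_derivative (4 * \<theta> * \<alpha> t * \<mu> t - a * \<mu> t - 2 * b * \<alpha> t)) (at t) \<and>
        (\<nu> has_real_derivative (2 * \<theta> * \<beta> t * \<mu> t - b * \<beta> t)) (at t) \<and>
        \<phi> t \<noteq> 0 \<and>
        (\<exists>\<phi>'. (\<phi> has_real_derivative \<phi>') (at t) \<and>
              \<phi>' / \<phi> t = \<theta> * (\<mu> t)\<^sup>2 + 2 * \<theta> * \<alpha> t - b * \<mu> t)"
    using P unfolding heat_kernel_on_def by blast
  define E where "E s x = exp (\<alpha> s * x\<^sup>2 + \<beta> s * x * x0 + \<gamma> s * x0\<^sup>2 + \<mu> s * x + \<nu> s * x0)" for s x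
  have PE: "P s x x0 = \<phi> s * E s x" if "s \<in> T" for s x
    using k that by (auto simp: E_def)
  from k T obtain \<phi>' where d:
    "(\<alpha> has_real_derivative (4 * \<theta> * (\<alpha> t)\<^sup>2 - 2 * a * \<alpha> t - \<rho>)) (at t)"
    "(\<beta> has_real_derivative (4 * \<theta> * \<alpha> t * \<beta> t - a * \<beta> t)) (at t)"
    "(\<gamma> has_real_derivative (\<theta> * (\<beta> t)\<^sup>2)) (at t)"
    "(\<mu> has_real_derivative (4 * \<theta> * \<alpha> t * \<mu> t - a * \<mu> t - 2 * b * \<alpha> t)) (at t)"
    "(\<nu> has_real_derivative (2 * \<theta> * \<beta> t * \<mu> t - b * \<beta> t)) (at t)"
    "(\<phi> has_real_derivative \<phi>') (at t)" "\<phi> t \<noteq> 0"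
    "\<phi>' / \<phi> t = \<theta> * (\<mu> t)\<^sup>2 + 2 * \<theta> * \<alpha> t - b * \<mu> t" by blast
  then have \<phi>': "\<phi>' = \<phi> t * (\<theta> * (\<mu> t)\<^sup>2 + 2 * \<theta> * \<alpha> t - b * \<mu> t)"
    by (simp add: field_simps)
  let ?m = "\<lambda>x. 2 * \<alpha> t * x + \<beta> t * x0 + \<mu> t"
  have E1: "(E t has_real_derivative ?m x * E t x) (at x)" for x
    unfolding E_def by (auto intro!: derivative_eq_intros simp: algebra_simps)
  have "((\<lambda>x. P t x x0) has_real_derivative \<phi> t * (?m x * E t x)) (at x)" for x
    using DERIV_cmult[OF E1] by (simp add: PE[OF T(2)])
  then have D1: "deriv (\<lambda>x. P t x x0) = (\<lambda>x. \<phi> t * (?m x * E t x))"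
    by (auto intro: DERIV_imp_deriv)
  have D2: "deriv (deriv (\<lambda>x. P t x x0)) x = \<phi> t * ((2 * \<alpha> t + (?m x)\<^sup>2) * E t x)"
    unfolding D1
    by (rule DERIV_imp_deriv)
      (auto intro!: derivative_eq_intros E1 simp: algebra_simps power2_eq_square)
  have Et: "((\<lambda>s. E s x) has_real_derivative
      ((4 * \<theta> * (\<alpha> t)\<^sup>2 - 2 * a * \<alpha> t - \<rho>) * x\<^sup>2
       + (4 * \<theta> * \<alpha> t * \<beta> t - a * \<beta> t) * x * x0 + \<theta> * (\<beta> t)\<^sup>2 * x0\<^sup>2
       + (4 * \<theta> * \<alpha> t * \<mu> t - a * \<mu> t - 2 * b * \<alpha> t) * x
       + (2 * \<theta> * \<beta> t * \<mu> t - b * \<beta> t) * x0) * E t x) (at t)"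
    (is "(_ has_real_derivative ?q * _) _")
    unfolding E_def by (auto intro!: derivative_eq_intros d)
  have "((\<lambda>s. \<phi> s * E s x) has_real_derivative \<phi>' * E t x + ?q * E t x * \<phi> t) (at t)"
    by (rule DERIV_mult[OF d(6) Et])
  also have "\<phi>' * E t x + ?q * E t x * \<phi> t = - perturbed_OU \<theta> a b \<rho> (\<lambda>x. P t x x0) x"
    unfolding perturbed_OU_def D2 unfolding D1 unfolding PE[OF T(2)] \<phi>' by algebra
  finally have "((\<lambda>s. \<phi> s * E s x) has_real_derivative
      - perturbed_OU \<theta> a b \<rho> (\<lambda>x. P t x x0) x) (at t)" .
  then show ?thesis
    by (rule has_field_derivative_transform_within_open[OF _ T]) (simp add: PE)
qed

end

theory Submission
  imports Defs
begin

text \<open>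
  The three formulas are one formula. Put \<open>\<kappa> = a\<^sup>2 + 4 \<rho> \<theta>\<close> and let \<open>S > 0\<close> and \<open>K\<close> be functions with
  \<open>K' = - S\<^sup>2\<close>, \<open>S' = - K S\<close> and \<open>K\<^sup>2 - S\<^sup>2 = \<kappa>\<close>. Then \<open>\<alpha> = \<gamma> = (a - K) / (4 \<theta>)\<close> and
  \<open>\<beta> = S / (2 \<theta>)\<close> solve the quadratic part of the system: since \<open>4 \<theta> \<alpha> - a = - K\<close>, the Riccati
  equation for \<open>\<alpha>\<close> reduces to \<open>K\<^sup>2 - \<kappa> = S\<^sup>2\<close>. Writing \<open>\<mu> = b / (2 \<theta>) - a b M / (2 \<theta>)\<close> and
  \<open>\<nu> = b / (2 \<theta>) + a b N / (2 \<theta>)\<close> turns the linear part into \<open>M' = 1 - K M\<close> and \<open>N' = - S M\<close>. In the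
  prefactor \<open>\<phi> = sqrt (S / (4 \<pi> \<theta>)) exp (a t / 2 + E)\<close> the square root has logarithmic derivative
  \<open>- K / 2\<close>, and completing the square in \<open>\<theta> \<mu>\<^sup>2 - b \<mu>\<close> leaves \<open>E' = b\<^sup>2 (a\<^sup>2 M\<^sup>2 - 1) / (4 \<theta>)\<close>.
  This is \<open>heat_kernel_on_of_system\<close>. According to the sign of \<open>\<kappa>\<close>, with \<open>\<omega> = sqrt \<bar>\<kappa>\<bar>\<close>, the theorem
  is the instance

  \<^item> \<open>K = \<omega> coth (\<omega> t)\<close>, \<open>S = \<omega> / sinh (\<omega> t)\<close>, \<open>M = coth (\<omega> t) / \<omega>\<close>, \<open>N = 1 / (\<omega> sinh (\<omega> t))\<close>;
  \<^item> \<open>K = S = 1 / t\<close>, \<open>M = t / 2\<close>, \<open>N = - t / 2\<close>;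
  \<^item> \<open>K = \<omega> cot (\<omega> t)\<close>, \<open>S = \<omega> / sin (\<omega> t)\<close>, \<open>M = - cot (\<omega> t) / \<omega>\<close>, \<open>N = - 1 / (\<omega> sin (\<omega> t))\<close>.

  The relation \<open>K\<^sup>2 - S\<^sup>2 = \<kappa>\<close> is then the Pythagorean identity for the hyperbolic or the circular
  functions. For \<open>\<kappa> \<noteq> 0\<close> one has \<open>M = K / \<kappa>\<close>, so the same identity splits \<open>E'\<close> into a multiple of
  \<open>S\<^sup>2\<close>, which integrates to the term in \<open>coth\<close> or \<open>cot\<close>, and the constant \<open>b\<^sup>2 (a\<^sup>2 / \<kappa> - 1) / (4 \<theta>) = - \<rho> b\<^sup>2 / \<kappa>\<close>.
\<close>

section \<open>Heat kernels from a reduced system\<close>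

text \<open>
  The derivative of \<open>\<alpha>\<close> serves twice below, because \<open>\<gamma> = \<alpha>\<close>: it equals the right-hand side of the
  Riccati equation and also \<open>\<theta> \<beta>\<^sup>2\<close>.
\<close>

lemma heat_kernel_on_of_system:
  fixes \<theta> a b \<rho> :: real and K S M N E :: "real \<Rightarrow> real"
  assumes "\<theta> > 0"
    and S_pos: "\<And>t. t \<in> T \<Longrightarrow> S t > 0"
    and K_S: "\<And>t. t \<in> T \<Longrightarrow> (K t)\<^sup>2 - (S t)\<^sup>2 = a\<^sup>2 + 4 * \<rho> * \<theta>"
    and K': "\<And>t. t \<in> T \<Longrightarrow> (K has_real_derivative - (S t)\<^sup>2) (at t)"
    and S': "\<And>t. t \<in> T \<Longrightarrow> (S has_real_derivative - K t * S t) (at t)"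
    and M': "\<And>t. t \<in> T \<Longrightarrow> (M has_real_derivative 1 - K t * M t) (at t)"
    and N': "\<And>t. t \<in> T \<Longrightarrow> (N has_real_derivative - S t * M t) (at t)"
    and E': "\<And>t. t \<in> T \<Longrightarrow>
      (E has_real_derivative b\<^sup>2 * (a\<^sup>2 * (M t)\<^sup>2 - 1) / (4 * \<theta>)) (at t)"
    and P: "\<And>t x x0. t \<in> T \<Longrightarrow> P t x x0 =
      sqrt (S t / (4 * pi * \<theta>)) * exp (a / 2 * t + E t
        + (a - K t) / (4 * \<theta>) * (x\<^sup>2 + x0\<^sup>2) + S t / (2 * \<theta>) * x * x0
        + (b / (2 * \<theta>) - a * b / (2 * \<theta>) * M t) * x
        + (b / (2 * \<theta>) + a * b / (2 * \<theta>) * N t) * x0)"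
  shows "heat_kernel_on \<theta> a b \<rho> T P"
proof -
  define \<alpha> where "\<alpha> t = (a - K t) / (4 * \<theta>)" for t
  define \<beta> where "\<beta> t = S t / (2 * \<theta>)" for t
  define \<mu> where "\<mu> t = b / (2 * \<theta>) - a * b / (2 * \<theta>) * M t" for t
  define \<nu> where "\<nu> t = b / (2 * \<theta>) + a * b / (2 * \<theta>) * N t" for t
  define \<phi> where "\<phi> t = sqrt (S t / (4 * pi * \<theta>)) * exp (a / 2 * t + E t)" for t
  have kernel: "P t x x0 =
      \<phi> t * exp (\<alpha> t * x\<^sup>2 + \<beta> t * x * x0 + \<alpha> t * x0\<^sup>2 + \<mu> t * x + \<nu> t * x0)" if "t \<in> T" for t x x0
    unfolding P[OF that] \<phi>_def \<alpha>_def \<beta>_def \<mu>_def \<nu>_def mult.assoc exp_add[symmetric]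
    by (simp add: algebra_simps diff_divide_distrib add_divide_distrib)
  have \<alpha>': "(\<alpha> has_real_derivative (S t)\<^sup>2 / (4 * \<theta>)) (at t)" if "t \<in> T" for t
    unfolding \<alpha>_def[abs_def] using \<open>\<theta> > 0\<close> by (auto intro!: derivative_eq_intros K' that)
  have riccati: "(S t)\<^sup>2 / (4 * \<theta>) = 4 * \<theta> * (\<alpha> t)\<^sup>2 - 2 * a * \<alpha> t - \<rho>" if "t \<in> T" for t
  proof -
    have S2: "(S t)\<^sup>2 = (K t)\<^sup>2 - a\<^sup>2 - 4 * \<rho> * \<theta>"
      using K_S[OF that] by simp
    show ?thesis
      unfolding S2 \<alpha>_def using \<open>\<theta> > 0\<close> by (simp add: field_simps power2_eq_square)
  qed
  have \<gamma>': "(S t)\<^sup>2 / (4 * \<theta>) = \<theta> * (\<beta> t)\<^sup>2" for t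
    unfolding \<beta>_def using \<open>\<theta> > 0\<close> by (simp add: field_simps power2_eq_square)
  have \<beta>': "(\<beta> has_real_derivative 4 * \<theta> * \<alpha> t * \<beta> t - a * \<beta> t) (at t)" if "t \<in> T" for t
    unfolding \<beta>_def[abs_def] \<alpha>_def using \<open>\<theta> > 0\<close>
    by (auto intro!: derivative_eq_intros S' that simp: field_simps)
  have \<mu>': "(\<mu> has_real_derivative 4 * \<theta> * \<alpha> t * \<mu> t - a * \<mu> t - 2 * b * \<alpha> t) (at t)"
    if "t \<in> T" for t
    unfolding \<mu>_def[abs_def] \<alpha>_def using \<open>\<theta> > 0\<close>
    by (auto intro!: derivative_eq_intros M' that simp: field_simps)
  have \<nu>': "(\<nu> has_real_derivative 2 * \<theta> * \<beta> t * \<mu> t - b * \<beta> t) (at t)" if "t \<in> T" for t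
    unfolding \<nu>_def[abs_def] \<beta>_def \<mu>_def using \<open>\<theta> > 0\<close>
    by (auto intro!: derivative_eq_intros N' that simp: field_simps)
  have \<phi>_pos: "\<phi> t > 0" if "t \<in> T" for t
    unfolding \<phi>_def using S_pos[OF that] \<open>\<theta> > 0\<close> by simp
  have \<phi>': "(\<phi> has_real_derivative \<phi> t * (\<theta> * (\<mu> t)\<^sup>2 + 2 * \<theta> * \<alpha> t - b * \<mu> t)) (at t)"
    if "t \<in> T" for t
  proof -
    define u where "u t = S t / (4 * pi * \<theta>)" for t
    have u_pos: "u t > 0"
      unfolding u_def using S_pos[OF that] \<open>\<theta> > 0\<close> by simp
    have u': "(u has_real_derivative - K t * u t) (at t)"
      unfolding u_def[abs_def] using \<open>\<theta> > 0\<close> by (auto intro!: derivative_eq_intros S' that)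
    have "((\<lambda>t. sqrt (u t)) has_real_derivative inverse (sqrt (u t)) / 2 * (- K t * u t)) (at t)"
      by (rule DERIV_chain2[OF DERIV_real_sqrt[OF u_pos] u'])
    moreover have "inverse (sqrt (u t)) / 2 * (- K t * u t) = - K t / 2 * sqrt (u t)"
      using u_pos real_div_sqrt[of "u t"] by (simp add: field_simps)
    ultimately have sqrt': "((\<lambda>t. sqrt (u t)) has_real_derivative - K t / 2 * sqrt (u t)) (at t)"
      by (simp only:)
    have "((\<lambda>t. sqrt (u t) * exp (a / 2 * t + E t)) has_real_derivative
        sqrt (u t) * exp (a / 2 * t + E t)
          * (a / 2 - K t / 2 + b\<^sup>2 * (a\<^sup>2 * (M t)\<^sup>2 - 1) / (4 * \<theta>))) (at t)"
      by (rule DERIV_cong[OF DERIV_mult[OF sqrt' DERIV_chain2[OF DERIV_exp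
            DERIV_add[OF DERIV_cmult_Id E'[OF that]]]]]) (simp add: algebra_simps)
    moreover have "a / 2 - K t / 2 + b\<^sup>2 * (a\<^sup>2 * (M t)\<^sup>2 - 1) / (4 * \<theta>)
        = \<theta> * (\<mu> t)\<^sup>2 + 2 * \<theta> * \<alpha> t - b * \<mu> t"
      unfolding \<mu>_def \<alpha>_def using \<open>\<theta> > 0\<close> by (simp add: field_simps power2_eq_square)
    ultimately show ?thesis
      by (simp add: \<phi>_def[abs_def] u_def)
  qed
  have prefactor: "\<exists>\<phi>'. (\<phi> has_real_derivative \<phi>') (at t) \<and>
      \<phi>' / \<phi> t = \<theta> * (\<mu> t)\<^sup>2 + 2 * \<theta> * \<alpha> t - b * \<mu> t" if "t \<in> T" for t
    using \<phi>'[OF that] \<phi>_pos[OF that] by (intro exI conjI) auto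
  show ?thesis
    unfolding heat_kernel_on_def
  proof ((rule exI)+, intro ballI conjI allI)
    fix t assume t: "t \<in> T"
    show "(\<alpha> has_real_derivative 4 * \<theta> * (\<alpha> t)\<^sup>2 - 2 * a * \<alpha> t - \<rho>) (at t)"
      using \<alpha>'[OF t] unfolding riccati[OF t] .
    show "(\<alpha> has_real_derivative \<theta> * (\<beta> t)\<^sup>2) (at t)"
      using \<alpha>'[OF t] unfolding \<gamma>' .
    show "\<phi> t \<noteq> 0"
      using \<phi>_pos[OF t] by simp
  qed (fact kernel \<beta>' \<mu>' \<nu>' prefactor)+
qed

section \<open>Hyperbolic and circular functions\<close>

lemma DERIV_coth_mult:
  assumes "sinh (w * t) \<noteq> 0"
  shows "((\<lambda>t. coth (w * t)) has_real_derivative - w / (sinh (w * t))\<^sup>2) (at t)"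
proof -
  have "w * sinh (w * t) * sinh (w * t) - cosh (w * t) * (w * cosh (w * t)) = - w"
    using hyperbolic_pythagoras[of "w * t"] by algebra
  then show ?thesis
    unfolding coth_def using assms
    by (auto intro!: derivative_eq_intros simp: power2_eq_square mult.commute mult.left_commute)
qed

lemma DERIV_cot_mult:
  fixes w t :: real
  assumes "sin (w * t) \<noteq> 0"
  shows "((\<lambda>t. cot (w * t)) has_real_derivative - w / (sin (w * t))\<^sup>2) (at t)"
  using DERIV_chain2[where f = cot, OF DERIV_cot[OF assms] DERIV_cmult_Id[of w t UNIV]]
  by (simp add: divide_inverse mult.commute)

lemma DERIV_inverse_sinh_mult:
  fixes w t :: real
  assumes "sinh (w * t) \<noteq> 0"
  shows "((\<lambda>t. 1 / sinh (w * t)) has_real_derivative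
    - w * coth (w * t) / sinh (w * t)) (at t)"
  unfolding coth_def using assms
  by (auto intro!: derivative_eq_intros simp: field_simps)

lemma DERIV_inverse_sin_mult:
  fixes w t :: real
  assumes "sin (w * t) \<noteq> 0"
  shows "((\<lambda>t. 1 / sin (w * t)) has_real_derivative
    - w * cot (w * t) / sin (w * t)) (at t)"
  unfolding cot_def using assms
  by (auto intro!: derivative_eq_intros simp: field_simps)

lemma coth_square_minus:
  assumes "sinh z \<noteq> 0"
  shows "(coth z)\<^sup>2 - 1 / (sinh z)\<^sup>2 = 1"
  unfolding coth_def using assms by (simp add: field_simps cosh_square_eq)

lemma cot_square_minus:
  fixes z :: real
  assumes "sin z \<noteq> 0"
  shows "(cot z)\<^sup>2 - 1 / (sin z)\<^sup>2 = - 1"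
  unfolding cot_def using assms by (simp add: field_simps cos_squared_eq)

section \<open>The three kernels\<close>

theorem theorem3p1:
  fixes \<theta> a b \<rho> :: real
  assumes "\<theta> > 0" and "\<rho> \<noteq> 0"
  shows
    "(a\<^sup>2 + 4 * \<rho> * \<theta> > 0 \<longrightarrow>
       (let \<omega> = sqrt (a\<^sup>2 + 4 * \<rho> * \<theta>) in
        heat_kernel_on \<theta> a b \<rho> {t. t > 0}
          (\<lambda>t x x0.
             sqrt (\<omega> / (4 * pi * \<theta> * sinh (\<omega> * t)))
             * exp ((a / 2 - \<rho> * b\<^sup>2 / (a\<^sup>2 + 4 * \<rho> * \<theta>)) * t
                    - a\<^sup>2 * b\<^sup>2 / (4 * \<theta> * \<omega> ^ 3) * coth (\<omega> * t))
             * exp ((a / (4 * \<theta>) - \<omega> / (4 * \<theta>) * coth (\<omega> * t)) * (x\<^sup>2 + x0\<^sup>2))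
             * exp (\<omega> / (2 * \<theta> * sinh (\<omega> * t)) * x * x0)
             * exp ((- (a * b / (2 * \<theta> * \<omega>)) * coth (\<omega> * t) + b / (2 * \<theta>)) * x)
             * exp ((a * b / (2 * \<theta> * \<omega> * sinh (\<omega> * t)) + b / (2 * \<theta>)) * x0))))
     \<and>
     (a\<^sup>2 + 4 * \<rho> * \<theta> = 0 \<longrightarrow>
        heat_kernel_on \<theta> a b \<rho> {t. t > 0}
          (\<lambda>t x x0.
             sqrt (1 / (4 * pi * \<theta> * t))
             * exp ((a / 2 - b\<^sup>2 / (4 * \<theta>)) * t + a\<^sup>2 * b\<^sup>2 / (48 * \<theta>) * t ^ 3)
             * exp ((a / (4 * \<theta>) - 1 / (4 * \<theta> * t)) * (x\<^sup>2 + x0\<^sup>2)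
                    + 1 / (2 * \<theta> * t) * x * x0
                    + (- (a * b / (4 * \<theta>)) * t + b / (2 * \<theta>)) * (x + x0))))
     \<and>
     (a\<^sup>2 + 4 * \<rho> * \<theta> < 0 \<longrightarrow>
       (let \<omega> = sqrt (- a\<^sup>2 - 4 * \<rho> * \<theta>) in
        heat_kernel_on \<theta> a b \<rho> {t. t > 0 \<and> sin (\<omega> * t) > 0}
          (\<lambda>t x x0.
             sqrt (\<omega> / (4 * pi * \<theta> * sin (\<omega> * t)))
             * exp ((a / 2 - \<rho> * b\<^sup>2 / (a\<^sup>2 + 4 * \<rho> * \<theta>)) * t
                    - a\<^sup>2 * b\<^sup>2 / (4 * \<theta> * \<omega> ^ 3) * cot (\<omega> * t))
             * exp ((a / (4 * \<theta>) - \<omega> / (4 * \<theta>) * cot (\<omega> * t)) * (x\<^sup>2 + x0\<^sup>2))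
             * exp (\<omega> / (2 * \<theta> * sin (\<omega> * t)) * x * x0)
             * exp ((a * b / (2 * \<theta> * \<omega>) * cot (\<omega> * t) + b / (2 * \<theta>)) * x)
             * exp ((- (a * b / (2 * \<theta> * \<omega> * sin (\<omega> * t))) + b / (2 * \<theta>)) * x0))))"
proof (intro conjI impI, goal_cases pos zero neg)
  case pos
  define \<omega> where "\<omega> = sqrt (a\<^sup>2 + 4 * \<rho> * \<theta>)"
  have \<omega>: "\<omega> > 0" and \<omega>2: "a\<^sup>2 + 4 * \<rho> * \<theta> = \<omega>\<^sup>2"
    using pos by (simp_all add: \<omega>_def)
  \<comment> \<open>Eliminating \<open>\<rho>\<close> makes the derivative of \<open>E\<close> a rational identity in \<open>\<omega>\<close>, \<open>a\<close>, \<open>b\<close>, \<open>\<theta>\<close>.\<close>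
  have \<rho>: "\<rho> = (\<omega>\<^sup>2 - a\<^sup>2) / (4 * \<theta>)"
    using \<omega>2 \<open>\<theta> > 0\<close> by (simp add: field_simps)
  have sinh_pos: "sinh (\<omega> * t) > 0" if "t > 0" for t
    using that \<omega> by simp
  show ?case
    unfolding Let_def \<omega>_def[symmetric] unfolding \<omega>2
  proof (rule heat_kernel_on_of_system[where
        S = "\<lambda>t. \<omega> * (1 / sinh (\<omega> * t))" and K = "\<lambda>t. \<omega> * coth (\<omega> * t)" and
        M = "\<lambda>t. coth (\<omega> * t) / \<omega>" and N = "\<lambda>t. (1 / sinh (\<omega> * t)) / \<omega>" and
        E = "\<lambda>t. - \<rho> * b\<^sup>2 / \<omega>\<^sup>2 * t - a\<^sup>2 * b\<^sup>2 / (4 * \<theta> * \<omega> ^ 3) * coth (\<omega> * t)"],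
      goal_cases \<theta>_pos S_pos K_S K_deriv S_deriv M_deriv N_deriv E_deriv kernel)
    case (K_S t)
    then have nz: "sinh (\<omega> * t) \<noteq> 0" using \<omega> by simp
    have "(\<omega> * coth (\<omega> * t))\<^sup>2 - (\<omega> * (1 / sinh (\<omega> * t)))\<^sup>2
        = \<omega>\<^sup>2 * ((coth (\<omega> * t))\<^sup>2 - 1 / (sinh (\<omega> * t))\<^sup>2)"
      by (simp add: power_mult_distrib power_divide algebra_simps)
    then show ?case
      by (simp add: coth_square_minus[OF nz] \<omega>2)
  next
    case (K_deriv t)
    then have nz: "sinh (\<omega> * t) \<noteq> 0" using \<omega> by simp
    show ?case
      using nz \<omega> by (auto intro!: derivative_eq_intros DERIV_coth_mult simp: power2_eq_square)
  next
    case (S_deriv t)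
    then have nz: "sinh (\<omega> * t) \<noteq> 0" using \<omega> by simp
    show ?case
      using \<omega> by (intro DERIV_cong[OF DERIV_cmult[OF DERIV_inverse_sinh_mult[OF nz]]]) simp
  next
    case (M_deriv t)
    then have nz: "sinh (\<omega> * t) \<noteq> 0" using \<omega> by simp
    have c: "1 - \<omega> * coth (\<omega> * t) * (coth (\<omega> * t) / \<omega>) = - 1 / (sinh (\<omega> * t))\<^sup>2"
      using coth_square_minus[OF nz] \<omega> by (simp add: power2_eq_square)
    show ?case
      unfolding c using nz \<omega> by (auto intro!: derivative_eq_intros DERIV_coth_mult)
  next
    case (N_deriv t)
    then have nz: "sinh (\<omega> * t) \<noteq> 0" using \<omega> by simp
    show ?case
      using \<omega> by (intro DERIV_cong[OF DERIV_cdivide[OF DERIV_inverse_sinh_mult[OF nz]]]) simp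
  next
    case (E_deriv t)
    then have nz: "sinh (\<omega> * t) \<noteq> 0" using \<omega> by simp
    have c: "(coth (\<omega> * t))\<^sup>2 = 1 + 1 / (sinh (\<omega> * t))\<^sup>2"
      using coth_square_minus[OF nz] by simp
    show ?case
      unfolding \<rho> power_divide c using nz \<omega> \<open>\<theta> > 0\<close>
      by (intro DERIV_cong[OF DERIV_diff[OF DERIV_cmult_Id DERIV_cmult[OF DERIV_coth_mult]]])
        (simp_all add: field_simps power2_eq_square power3_eq_cube)
  next
    case (kernel t x x0)
    show ?case
      by (simp only: mult.assoc exp_add[symmetric])
        (simp add: algebra_simps diff_divide_distrib add_divide_distrib)
  qed (use \<open>\<theta> > 0\<close> \<omega> sinh_pos in auto)
next
  case zero
  show ?case
  proof (rule heat_kernel_on_of_system[where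
        S = "\<lambda>t. 1 / t" and K = "\<lambda>t. 1 / t" and
        M = "\<lambda>t. t / 2" and N = "\<lambda>t. - t / 2" and
        E = "\<lambda>t. - b\<^sup>2 / (4 * \<theta>) * t + a\<^sup>2 * b\<^sup>2 / (48 * \<theta>) * t ^ 3"],
      goal_cases \<theta>_pos S_pos K_S K_deriv S_deriv M_deriv N_deriv E_deriv kernel)
    case (E_deriv t)
    then show ?case
      using \<open>\<theta> > 0\<close>
      by (auto intro!: derivative_eq_intros simp: field_simps power2_eq_square)
  next
    case (kernel t x x0)
    have "sqrt (1 / t / (4 * pi * \<theta>)) = sqrt (1 / (4 * pi * \<theta> * t))"
      by (simp add: mult.commute)
    then show ?case
      by (simp only: mult.assoc exp_add[symmetric])
        (simp add: algebra_simps diff_divide_distrib add_divide_distrib)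
  qed (use zero \<open>\<theta> > 0\<close> in \<open>auto intro!: derivative_eq_intros simp: field_simps power2_eq_square\<close>)
next
  case neg
  define \<omega> where "\<omega> = sqrt (- a\<^sup>2 - 4 * \<rho> * \<theta>)"
  have \<omega>: "\<omega> > 0" and "- a\<^sup>2 - 4 * \<rho> * \<theta> = \<omega>\<^sup>2"
    using neg by (simp_all add: \<omega>_def)
  then have \<omega>2: "a\<^sup>2 + 4 * \<rho> * \<theta> = - \<omega>\<^sup>2"
    by simp
  have \<rho>: "\<rho> = (- \<omega>\<^sup>2 - a\<^sup>2) / (4 * \<theta>)"
    using \<omega>2 \<open>\<theta> > 0\<close> by (simp add: field_simps)
  show ?case
    unfolding Let_def \<omega>_def[symmetric] unfolding \<omega>2
  proof (rule heat_kernel_on_of_system[where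
        S = "\<lambda>t. \<omega> * (1 / sin (\<omega> * t))" and K = "\<lambda>t. \<omega> * cot (\<omega> * t)" and
        M = "\<lambda>t. - cot (\<omega> * t) / \<omega>" and N = "\<lambda>t. - (1 / sin (\<omega> * t)) / \<omega>" and
        E = "\<lambda>t. \<rho> * b\<^sup>2 / \<omega>\<^sup>2 * t - a\<^sup>2 * b\<^sup>2 / (4 * \<theta> * \<omega> ^ 3) * cot (\<omega> * t)"],
      goal_cases \<theta>_pos S_pos K_S K_deriv S_deriv M_deriv N_deriv E_deriv kernel)
    case (K_S t)
    then have nz: "sin (\<omega> * t) \<noteq> 0" by simp
    have "(\<omega> * cot (\<omega> * t))\<^sup>2 - (\<omega> * (1 / sin (\<omega> * t)))\<^sup>2
        = \<omega>\<^sup>2 * ((cot (\<omega> * t))\<^sup>2 - 1 / (sin (\<omega> * t))\<^sup>2)"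
      by (simp add: power_mult_distrib power_divide algebra_simps)
    then show ?case
      by (simp add: cot_square_minus[OF nz] \<omega>2)
  next
    case (K_deriv t)
    then have nz: "sin (\<omega> * t) \<noteq> 0" by simp
    show ?case
      using nz \<omega> by (auto intro!: derivative_eq_intros DERIV_cot_mult simp: power2_eq_square)
  next
    case (S_deriv t)
    then have nz: "sin (\<omega> * t) \<noteq> 0" by simp
    show ?case
      using \<omega> by (intro DERIV_cong[OF DERIV_cmult[OF DERIV_inverse_sin_mult[OF nz]]]) simp
  next
    case (M_deriv t)
    then have nz: "sin (\<omega> * t) \<noteq> 0" by simp
    have c: "1 - \<omega> * cot (\<omega> * t) * (- cot (\<omega> * t) / \<omega>) = 1 / (sin (\<omega> * t))\<^sup>2"
      using cot_square_minus[OF nz] \<omega> by (simp add: power2_eq_square)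
    show ?case
      unfolding c using nz \<omega> by (auto intro!: derivative_eq_intros DERIV_cot_mult)
  next
    case (N_deriv t)
    then have nz: "sin (\<omega> * t) \<noteq> 0" by simp
    show ?case
      using \<omega>
      by (intro DERIV_cong[OF DERIV_cdivide[OF DERIV_minus[OF DERIV_inverse_sin_mult[OF nz]]]]) simp
  next
    case (E_deriv t)
    then have nz: "sin (\<omega> * t) \<noteq> 0" by simp
    have c: "(- cot (\<omega> * t))\<^sup>2 = 1 / (sin (\<omega> * t))\<^sup>2 - 1"
      using cot_square_minus[OF nz] by simp
    show ?case
      unfolding \<rho> power_divide c using nz \<omega> \<open>\<theta> > 0\<close>
      by (intro DERIV_cong[OF DERIV_diff[OF DERIV_cmult_Id DERIV_cmult[OF DERIV_cot_mult]]])
        (simp_all add: field_simps power2_eq_square power3_eq_cube)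
  next
    case (kernel t x x0)
    show ?case
      by (simp only: mult.assoc exp_add[symmetric])
        (simp add: algebra_simps diff_divide_distrib add_divide_distrib)
  qed (use \<open>\<theta> > 0\<close> \<omega> in auto)
qed

end
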